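(* Let $\mathcal B$ be a building with chamber set $C$. Let $V$ be the vertex set of the subdivided Davis complex $\Delta_D$ of $\mathcal B$. The following topologies on $\mathrm{Aut}(\mathcal B)$ coincide. (i) The topology of pointwise convergence on the discrete set $C$. (ii) The topology of pointwise convergence on the discrete set $V$. (iii) The topology of pointwise convergence (as maps $|\Delta_D|\to|\Delta_D|$), for any topology on $|\Delta_D|$ in which $V$ is a discrete subset. (iv) The compact-open topology, for the weak topology on $|\Delta_D|$. Suppose that $\mathrm{Aut}(\mathcal B)$ carries this topology and that $|\Delta_D|$ carries some topology. Then the joint evaluation map $\mathrm{Aut}(\mathcal B)\times|\Delta_D|\to|\Delta_D|$ is continuous if one of the following holds. (a) The topology on $|\Delta_D|$ is $\mathrm{Aut}(\mathcal B)$-invariant and locally finite. (b) The topology on $|\Delta_D|$ comes from an $\mathrm{Aut}(\mathcal B)$-invariant metric $d$ in which $V$ is discrete.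
   Context: All topological spaces and groups are Hausdorff. Coxeter systems. Let $I$ be a finite set and $(m_{i,j})_{i,j\in I}$ a symmetric matrix with entries in $\{1,2,3,\ldots,\infty\}$, $m_{i,i}=1$ and $m_{i,j}\ge 2$ for $i\ne j$. The associated Coxeter system $(W,I)$ consists of the group $W=\langle I\mid (ij)^{m_{i,j}}=1 \text{ if } m_{i,j}\neq\infty\rangle$ and its generating set $I$; $\ell$ is the word length, and $w=i_1\cdots i_m$ is reduced if $\ell(w)=m$. For $J\subseteq I$, $W_J$ is the subgroup generated by $J$. Buildings. A building $\mathcal B=(C,EC,t,\delta)$ of type $(W,I)$ consists of a simplicial graph $(C,EC)$ with vertex set $C$ (the chambers) and edge set $EC$, an edge coloring $t:EC\to I$, and a map $\delta:C\times C\to W$. Chambers joined by an edge of color $i$ are called $i$-adjacent. A gallery of type $(i_1,\ldots,i_m)$ is a sequence $(c_0,\ldots,c_m)$ of chambers with $c_{s-1}$ $i_s$-adjacent to $c_s$. Axioms: (B1) for every chamber $a$ and $i\in I$ there is at least one chamber $b$ which is $i$-adjacent to $a$, and if another chamber $c$ is $i$-adjacent to $a$, then $b$ and $c$ are $i$-adjacent; (B2) if $w=i_1\cdots i_m$ is reduced, then $\delta(a,b)=w$ if and only if there is a gallery of type $(i_1,\ldots,i_m)$ from $a$ to $b$. $\mathrm{Aut}(\mathcal B)$ is the group of all graph automorphisms of $(C,EC)$ preserving the edge coloring. Simplicial complexes. A simplicial complex $\Delta$ with vertex set $V$ is a set of finite subsets of $V$, closed under passing to subsets, with $\bigcup\Delta=V$.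 In the real vector space $\mathbb R^{(V)}$ with basis $V$ let $|a|$ be the convex hull of $a\in\Delta$; the geometric realization is the set $|\Delta|=\bigcup_{a\in\Delta}|a|$. In the weak topology, $A\subseteq|\Delta|$ is closed iff $A\cap|a|$ is closed in $|a|$ (with its natural compact topology) for all $a\in\Delta$. Simplicial maps (maps between vertex sets taking simplices to simplices) are extended linearly to the geometric realizations. A topology on $|\Delta|$ is called locally finite if every $x\in|\Delta|$ has a neighborhood contained in the geometric realization of a finite subcomplex of $\Delta$. Subdivided Davis complex. For $c\in C$ and $J\subseteq I$, the residue $\mathrm{Res}_J(c)$ is the subgraph consisting of all chambers that can be reached from $c$ by galleries whose edge colors are in $J$, with the edges between them. It is called spherical if $W_J$ is finite. The subdivided Davis complex $\Delta_D$ has as vertex set $V$ the set of all spherical residues of $\mathcal B$ (chambers are the residues with $J=\varnothing$), and its simplices are the finite ascending chains $\mathrm{Res}_{J_0}(c)\subseteq\mathrm{Res}_{J_1}(c)\subseteq\cdots\subseteq\mathrm{Res}_{J_m}(c)$ with $J_0\subseteq\cdots\subseteq J_m$ and $W_{J_m}$ finite. $\mathrm{Aut}(\mathcal B)$ acts on $\Delta_D$, hence on $|\Delta_D|$. A topology (resp. metric) on $|\Delta_D|$ is invariant if $\mathrm{Aut}(\mathcal B)$ acts by homeomorphisms (resp. isometries). A subset is discrete if its subspace topology is discrete. *)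

theory Defs
  imports
    "HOL-Analysis.Analysis"
    "HOL-Library.Extended_Nat"
    "HOL-Algebra.Bij"
    "HOL-Algebra.Generated_Groups"
begin

section \<open>Coxeter systems\<close>

text \<open>
  Groups given by generators and relators. A letter is a generator with a sign,
  \<open>(True, x)\<close> standing for \<open>x\<close> and \<open>(False, x)\<close> for its formal inverse; the group is the
  set of words in the letters modulo free cancellation and insertion or deletion of relators.
\<close>

inductive pres_eq :: "'i set \<Rightarrow> (bool \<times> 'i) list set \<Rightarrow> (bool \<times> 'i) list \<Rightarrow> (bool \<times> 'i) list \<Rightarrow> bool"
  for X R where
  refl: "u \<in> lists (UNIV \<times> X) \<Longrightarrow> pres_eq X R u u"
| sym: "pres_eq X R u v \<Longrightarrow> pres_eq X R v u"
| trans: "pres_eq X R u v \<Longrightarrow> pres_eq X R v w \<Longrightarrow> pres_eq X R u w"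
| cancel: "u \<in> lists (UNIV \<times> X) \<Longrightarrow> v \<in> lists (UNIV \<times> X) \<Longrightarrow> x \<in> X \<Longrightarrow>
    pres_eq X R (u @ [(b, x), (\<not> b, x)] @ v) (u @ v)"
| relator: "u \<in> lists (UNIV \<times> X) \<Longrightarrow> v \<in> lists (UNIV \<times> X) \<Longrightarrow> r \<in> R \<Longrightarrow> r \<in> lists (UNIV \<times> X) \<Longrightarrow>
    pres_eq X R (u @ r @ v) (u @ v)"

definition pres_class :: "'i set \<Rightarrow> (bool \<times> 'i) list set \<Rightarrow> (bool \<times> 'i) list \<Rightarrow> (bool \<times> 'i) list set" where
  "pres_class X R u = {v. pres_eq X R u v}"

definition presented_group :: "'i set \<Rightarrow> (bool \<times> 'i) list set \<Rightarrow> (bool \<times> 'i) list set monoid" where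
  "presented_group X R =
    \<lparr>carrier = pres_class X R ` lists (UNIV \<times> X),
     mult = (\<lambda>A B. {w. \<exists>u\<in>A. \<exists>v\<in>B. pres_eq X R (u @ v) w}),
     one = pres_class X R []\<rparr>"

locale coxeter_matrix =
  fixes I :: "'i set" and m :: "'i \<Rightarrow> 'i \<Rightarrow> enat"
  assumes finite_I: "finite I"
    and symmetric: "\<And>i j. i \<in> I \<Longrightarrow> j \<in> I \<Longrightarrow> m i j = m j i"
    and diagonal: "\<And>i. i \<in> I \<Longrightarrow> m i i = 1"
    and off_diagonal: "\<And>i j. i \<in> I \<Longrightarrow> j \<in> I \<Longrightarrow> i \<noteq> j \<Longrightarrow> m i j \<ge> 2"

definition coxeter_relators :: "'i set \<Rightarrow> ('i \<Rightarrow> 'i \<Rightarrow> enat) \<Rightarrow> (bool \<times> 'i) list set" where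
  "coxeter_relators I m =
    {concat (replicate n [(True, i), (True, j)]) | i j n. i \<in> I \<and> j \<in> I \<and> m i j = enat n}"

definition coxeter_group :: "'i set \<Rightarrow> ('i \<Rightarrow> 'i \<Rightarrow> enat) \<Rightarrow> (bool \<times> 'i) list set monoid" where
  "coxeter_group I m = presented_group I (coxeter_relators I m)"

definition coxeter_gen :: "'i set \<Rightarrow> ('i \<Rightarrow> 'i \<Rightarrow> enat) \<Rightarrow> 'i \<Rightarrow> (bool \<times> 'i) list set" where
  "coxeter_gen I m i = pres_class I (coxeter_relators I m) [(True, i)]"

definition coxeter_prod :: "'i set \<Rightarrow> ('i \<Rightarrow> 'i \<Rightarrow> enat) \<Rightarrow> 'i list \<Rightarrow> (bool \<times> 'i) list set" where
  "coxeter_prod I m is =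
    foldr (\<lambda>i w. coxeter_gen I m i \<otimes>\<^bsub>coxeter_group I m\<^esub> w) is \<one>\<^bsub>coxeter_group I m\<^esub>"

text \<open>The generators are involutions, so no inverses are needed in the word length.\<close>

definition coxeter_length :: "'i set \<Rightarrow> ('i \<Rightarrow> 'i \<Rightarrow> enat) \<Rightarrow> (bool \<times> 'i) list set \<Rightarrow> nat" where
  "coxeter_length I m w = (LEAST n. \<exists>is\<in>lists I. length is = n \<and> coxeter_prod I m is = w)"

definition reduced_word :: "'i set \<Rightarrow> ('i \<Rightarrow> 'i \<Rightarrow> enat) \<Rightarrow> 'i list \<Rightarrow> bool" where
  "reduced_word I m is \<longleftrightarrow>
    is \<in> lists I \<and> coxeter_length I m (coxeter_prod I m is) = length is"

definition parabolic :: "'i set \<Rightarrow> ('i \<Rightarrow> 'i \<Rightarrow> enat) \<Rightarrow> 'i set \<Rightarrow> (bool \<times> 'i) list set set" where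
  "parabolic I m J = generate (coxeter_group I m) (coxeter_gen I m ` J)"


section \<open>Buildings\<close>

record ('c, 'i) building_data =
  chambers :: "'c set"
  edges :: "'c set set"
  color :: "'c set \<Rightarrow> 'i"
  wdist :: "'c \<Rightarrow> 'c \<Rightarrow> (bool \<times> 'i) list set"

definition adjacent :: "('c, 'i) building_data \<Rightarrow> 'i \<Rightarrow> 'c \<Rightarrow> 'c \<Rightarrow> bool" where
  "adjacent B i a b \<longleftrightarrow> {a, b} \<in> edges B \<and> color B {a, b} = i"

definition gallery :: "('c, 'i) building_data \<Rightarrow> 'i list \<Rightarrow> 'c list \<Rightarrow> bool" where
  "gallery B is cs \<longleftrightarrow>
    set cs \<subseteq> chambers B \<and> length cs = Suc (length is) \<and>
    (\<forall>s<length is. adjacent B (is ! s) (cs ! s) (cs ! Suc s))"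

locale building = coxeter_matrix I m
  for I :: "'i set" and m :: "'i \<Rightarrow> 'i \<Rightarrow> enat" +
  fixes B :: "('c, 'i) building_data"
  assumes edges: "edges B \<subseteq> {{a, b} | a b. a \<in> chambers B \<and> b \<in> chambers B \<and> a \<noteq> b}"
    and color: "color B \<in> edges B \<rightarrow> I"
    and wdist: "\<And>a b. a \<in> chambers B \<Longrightarrow> b \<in> chambers B \<Longrightarrow> wdist B a b \<in> carrier (coxeter_group I m)"
    and B1_ex: "\<And>a i. a \<in> chambers B \<Longrightarrow> i \<in> I \<Longrightarrow> \<exists>b\<in>chambers B. adjacent B i a b"
    and B1_adj: "\<And>a b c i. a \<in> chambers B \<Longrightarrow> b \<in> chambers B \<Longrightarrow> c \<in> chambers B \<Longrightarrow> i \<in> I \<Longrightarrow>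
      adjacent B i a b \<Longrightarrow> adjacent B i a c \<Longrightarrow> b \<noteq> c \<Longrightarrow> adjacent B i b c"
    and B2: "\<And>is a b. reduced_word I m is \<Longrightarrow> a \<in> chambers B \<Longrightarrow> b \<in> chambers B \<Longrightarrow>
      wdist B a b = coxeter_prod I m is \<longleftrightarrow> (\<exists>cs. gallery B is cs \<and> hd cs = a \<and> last cs = b)"

text \<open>
  The color-preserving automorphisms, as a subgroup of the group of permutations of the set
  of chambers. Elements of \<open>Bij\<close> are \<open>undefined\<close> outside that set, so that equality of
  automorphisms is equality of functions.
\<close>

definition building_Aut :: "('c, 'i) building_data \<Rightarrow> ('c \<Rightarrow> 'c) monoid" where
  "building_Aut B = BijGroup (chambers B)
    \<lparr>carrier := {g \<in> Bij (chambers B). \<forall>a\<in>chambers B. \<forall>b\<in>chambers B.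
        ({g a, g b} \<in> edges B \<longleftrightarrow> {a, b} \<in> edges B) \<and>
        ({a, b} \<in> edges B \<longrightarrow> color B {g a, g b} = color B {a, b})}\<rparr>"


section \<open>Simplicial complexes and their geometric realizations\<close>

definition abstract_complex :: "'v set \<Rightarrow> 'v set set \<Rightarrow> bool" where
  "abstract_complex V \<Delta> \<longleftrightarrow>
    (\<forall>a\<in>\<Delta>. finite a) \<and> (\<forall>a\<in>\<Delta>. \<forall>b. b \<subseteq> a \<longrightarrow> b \<in> \<Delta>) \<and> \<Union>\<Delta> = V"

definition finite_subcomplex :: "'v set set \<Rightarrow> 'v set set \<Rightarrow> bool" where
  "finite_subcomplex F \<Delta> \<longleftrightarrow> finite F \<and> F \<subseteq> \<Delta> \<and> abstract_complex (\<Union>F) F"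

text \<open>
  Elements of the real vector space with basis \<open>V\<close> are represented by their coordinate
  functions; the convex hull of the basis vectors in \<open>a\<close> consists of the convex
  combinations of these vectors.
\<close>

definition vertex_point :: "'v \<Rightarrow> 'v \<Rightarrow> real" where
  "vertex_point v = indicator {v}"

definition simplex_realization :: "'v set \<Rightarrow> ('v \<Rightarrow> real) set" where
  "simplex_realization a = {x. (\<forall>v. 0 \<le> x v) \<and> (\<forall>v. v \<notin> a \<longrightarrow> x v = 0) \<and> (\<Sum>v\<in>a. x v) = 1}"

definition realization :: "'v set set \<Rightarrow> ('v \<Rightarrow> real) set" where
  "realization \<Delta> = (\<Union>a\<in>\<Delta>. simplex_realization a)"

definition linear_extension :: "('v \<Rightarrow> 'w) \<Rightarrow> ('v \<Rightarrow> real) \<Rightarrow> 'w \<Rightarrow> real" where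
  "linear_extension f x = (\<lambda>w. \<Sum>v | x v \<noteq> 0 \<and> f v = w. x v)"

text \<open>
  The functions in \<open>simplex_realization a\<close> vanish outside of the finite set \<open>a\<close>, so the
  product topology of \<open>'v \<Rightarrow> real\<close> induces on it the usual topology of a Euclidean simplex.
\<close>

definition weak_topology :: "'v set set \<Rightarrow> ('v \<Rightarrow> real) topology" where
  "weak_topology \<Delta> = topology (\<lambda>U. U \<subseteq> realization \<Delta> \<and>
    (\<forall>a\<in>\<Delta>. closedin (top_of_set (simplex_realization a))
      ((realization \<Delta> - U) \<inter> simplex_realization a)))"

definition locally_finite_topology :: "'v set set \<Rightarrow> ('v \<Rightarrow> real) topology \<Rightarrow> bool" where
  "locally_finite_topology \<Delta> T \<longleftrightarrow>
    (\<forall>x\<in>realization \<Delta>. \<exists>U F. openin T U \<and> x \<in> U \<and> finite_subcomplex F \<Delta> \<and> U \<subseteq> realization F)"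

definition discrete_subset :: "'a topology \<Rightarrow> 'a set \<Rightarrow> bool" where
  "discrete_subset T S \<longleftrightarrow> S \<subseteq> topspace T \<and> subtopology T S = discrete_topology S"


section \<open>The subdivided Davis complex\<close>

text \<open>A residue, being a full subgraph, is represented by its set of chambers.\<close>

definition residue :: "('c, 'i) building_data \<Rightarrow> 'i set \<Rightarrow> 'c \<Rightarrow> 'c set" where
  "residue B J c = {d. \<exists>is cs. set is \<subseteq> J \<and> gallery B is cs \<and> hd cs = c \<and> last cs = d}"

definition spherical_residues ::
    "'i set \<Rightarrow> ('i \<Rightarrow> 'i \<Rightarrow> enat) \<Rightarrow> ('c, 'i) building_data \<Rightarrow> 'c set set" where
  "spherical_residues I m B =
    {residue B J c | J c. J \<subseteq> I \<and> c \<in> chambers B \<and> finite (parabolic I m J)}"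

text \<open>The empty simplex is included, so that the simplices are closed under passing to subsets.\<close>

definition davis_complex ::
    "'i set \<Rightarrow> ('i \<Rightarrow> 'i \<Rightarrow> enat) \<Rightarrow> ('c, 'i) building_data \<Rightarrow> 'c set set set" where
  "davis_complex I m B = insert {}
    {(\<lambda>J. residue B J c) ` set Js | Js c. c \<in> chambers B \<and> Js \<noteq> [] \<and> set Js \<subseteq> Pow I \<and>
      sorted_wrt (\<subseteq>) Js \<and> finite (parabolic I m (last Js))}"

text \<open>The action of an automorphism on residues, and on the geometric realization.\<close>

definition residue_action :: "('c \<Rightarrow> 'c) \<Rightarrow> 'c set \<Rightarrow> 'c set" where
  "residue_action g R = g ` R"

definition davis_action :: "('c \<Rightarrow> 'c) \<Rightarrow> ('c set \<Rightarrow> real) \<Rightarrow> 'c set \<Rightarrow> real" where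
  "davis_action g = linear_extension (residue_action g)"


section \<open>Topologies on sets of transformations\<close>

text \<open>
  In the following, \<open>G\<close> is a set of transformations whose elements \<open>g\<close> are regarded, via
  \<open>act g\<close>, as self-maps of \<open>topspace T\<close>.
\<close>

definition pointwise_topology :: "'g set \<Rightarrow> ('g \<Rightarrow> 'x \<Rightarrow> 'x) \<Rightarrow> 'x topology \<Rightarrow> 'g topology" where
  "pointwise_topology G act T =
    pullback_topology G (\<lambda>g. restrict (act g) (topspace T)) (product_topology (\<lambda>_. T) (topspace T))"

definition compact_open_topology :: "'g set \<Rightarrow> ('g \<Rightarrow> 'x \<Rightarrow> 'x) \<Rightarrow> 'x topology \<Rightarrow> 'g topology" where
  "compact_open_topology G act T =
    topology_generated_by {{g \<in> G. act g ` K \<subseteq> U} | K U. compactin T K \<and> openin T U}"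


section \<open>Consistency of the definitions\<close>

lemma pres_eq_lists: "pres_eq X R u v \<Longrightarrow> u \<in> lists (UNIV \<times> X) \<and> v \<in> lists (UNIV \<times> X)"
  by (induction rule: pres_eq.induct) auto

lemma pres_eq_append_right:
  assumes "pres_eq X R u v" "w \<in> lists (UNIV \<times> X)"
  shows "pres_eq X R (u @ w) (v @ w)"
  using assms
proof (induction rule: pres_eq.induct)
  case (refl u) then show ?case by (intro pres_eq.refl) auto
next case (sym u v) then show ?case by (auto intro: pres_eq.sym)
next case (trans u v w) then show ?case by (auto intro: pres_eq.trans)
next case (cancel u v x b)
  then show ?case using pres_eq.cancel[of u X "v @ w" x R b] by auto
next case (relator u v r)
  then show ?case using pres_eq.relator[of u X "v @ w" r R] by auto
qed

lemma pres_eq_append_left: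
  assumes "pres_eq X R u v" "w \<in> lists (UNIV \<times> X)"
  shows "pres_eq X R (w @ u) (w @ v)"
  using assms
proof (induction rule: pres_eq.induct)
  case (refl u) then show ?case by (intro pres_eq.refl) auto
next case (sym u v) then show ?case by (auto intro: pres_eq.sym)
next case (trans u v w) then show ?case by (auto intro: pres_eq.trans)
next case (cancel u v x b)
  then show ?case using pres_eq.cancel[of "w @ u" X v x R b] by auto
next case (relator u v r)
  then show ?case using pres_eq.relator[of "w @ u" X v r R] by auto
qed

lemma pres_eq_append:
  "pres_eq X R u u' \<Longrightarrow> pres_eq X R v v' \<Longrightarrow> pres_eq X R (u @ v) (u' @ v')"
  by (meson pres_eq.trans pres_eq_append_left pres_eq_append_right pres_eq_lists)

lemma pres_class_eq_iff:
  assumes "u \<in> lists (UNIV \<times> X)"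
  shows "pres_class X R u = pres_class X R v \<longleftrightarrow> pres_eq X R u v"
  unfolding pres_class_def using assms pres_eq.refl pres_eq.sym pres_eq.trans by blast

lemma mult_pres_class:
  assumes "u \<in> lists (UNIV \<times> X)" "v \<in> lists (UNIV \<times> X)"
  shows "pres_class X R u \<otimes>\<^bsub>presented_group X R\<^esub> pres_class X R v = pres_class X R (u @ v)"
proof -
  have "pres_eq X R (u @ v) w" if "pres_eq X R u u'" "pres_eq X R v v'" "pres_eq X R (u' @ v') w"
    for u' v' w
    using that by (meson pres_eq.trans pres_eq_append)
  with assms show ?thesis
    unfolding presented_group_def pres_class_def by (auto intro: pres_eq.refl)
qed

definition inv_word :: "(bool \<times> 'i) list \<Rightarrow> (bool \<times> 'i) list" where
  "inv_word u = rev (map (\<lambda>(b, x). (\<not> b, x)) u)"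

lemma inv_word_eq:
  assumes "u \<in> lists (UNIV \<times> X)"
  shows "inv_word u \<in> lists (UNIV \<times> X)" "pres_eq X R (inv_word u @ u) []"
proof -
  have *: "inv_word v \<in> lists (UNIV \<times> X)" if "v \<in> lists (UNIV \<times> X)" for v
    using that by (auto simp: inv_word_def)
  then show "inv_word u \<in> lists (UNIV \<times> X)" using assms by blast
  show "pres_eq X R (inv_word u @ u) []" using assms
  proof (induction u rule: list.induct)
    case Nil then show ?case by (auto simp: inv_word_def intro: pres_eq.refl)
  next
    case (Cons a u)
    obtain b x where a: "a = (b, x)" by force
    have "pres_eq X R (inv_word u @ [(\<not> b, x), (\<not> \<not> b, x)] @ u) (inv_word u @ u)"
    proof (rule pres_eq.cancel)
      show "u \<in> lists (UNIV \<times> X)" "x \<in> X"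
        using Cons.prems unfolding Cons_in_lists_iff a by blast+
      then show "inv_word u \<in> lists (UNIV \<times> X)" by (intro *)
    qed
    moreover have "pres_eq X R (inv_word u @ u) []" using Cons by simp
    moreover have "inv_word (a # u) @ a # u = inv_word u @ [(\<not> b, x), (\<not> \<not> b, x)] @ u"
      by (simp add: inv_word_def a)
    ultimately show ?case by (metis pres_eq.trans)
  qed
qed

lemma group_presented_group: "group (presented_group X R)"
proof (rule groupI)
  let ?P = "presented_group X R"
  have car: "carrier ?P = pres_class X R ` lists (UNIV \<times> X)"
    and one: "\<one>\<^bsub>?P\<^esub> = pres_class X R []"
    by (simp_all add: presented_group_def)
  have cases: "thesis" if "x \<in> carrier ?P"
      "\<And>u. u \<in> lists (UNIV \<times> X) \<Longrightarrow> x = pres_class X R u \<Longrightarrow> thesis" for x thesis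
    using that unfolding car by (elim imageE)
  have in_car: "pres_class X R u \<in> carrier ?P" if "u \<in> lists (UNIV \<times> X)" for u
    unfolding car using that by (rule imageI)
  show "\<one>\<^bsub>?P\<^esub> \<in> carrier ?P"
    unfolding one by (rule in_car) simp
  show "x \<otimes>\<^bsub>?P\<^esub> y \<in> carrier ?P" if x: "x \<in> carrier ?P" and y: "y \<in> carrier ?P" for x y
  proof (rule cases[OF x], rule cases[OF y])
    fix u v assume "u \<in> lists (UNIV \<times> X)" "v \<in> lists (UNIV \<times> X)"
      "x = pres_class X R u" "y = pres_class X R v"
    then show ?thesis by (simp only: mult_pres_class in_car append_in_lists_conv simp_thms)
  qed
  show "x \<otimes>\<^bsub>?P\<^esub> y \<otimes>\<^bsub>?P\<^esub> z = x \<otimes>\<^bsub>?P\<^esub> (y \<otimes>\<^bsub>?P\<^esub> z)"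
    if x: "x \<in> carrier ?P" and y: "y \<in> carrier ?P" and z: "z \<in> carrier ?P" for x y z
  proof (rule cases[OF x], rule cases[OF y], rule cases[OF z])
    fix u v w assume "u \<in> lists (UNIV \<times> X)" "v \<in> lists (UNIV \<times> X)" "w \<in> lists (UNIV \<times> X)"
      "x = pres_class X R u" "y = pres_class X R v" "z = pres_class X R w"
    then show ?thesis by (simp only: mult_pres_class append_in_lists_conv simp_thms append_assoc)
  qed
  show "\<one>\<^bsub>?P\<^esub> \<otimes>\<^bsub>?P\<^esub> x = x" if x: "x \<in> carrier ?P" for x
  proof (rule cases[OF x])
    fix u assume "u \<in> lists (UNIV \<times> X)" "x = pres_class X R u"
    then show ?thesis by (simp only: one mult_pres_class lists.Nil append_Nil)
  qed
  show "\<exists>y\<in>carrier ?P. y \<otimes>\<^bsub>?P\<^esub> x = \<one>\<^bsub>?P\<^esub>" if x: "x \<in> carrier ?P" for x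
  proof (rule cases[OF x])
    fix u assume u: "u \<in> lists (UNIV \<times> X)" "x = pres_class X R u"
    have v: "inv_word u @ u \<in> lists (UNIV \<times> X)"
      unfolding append_in_lists_conv using u(1) inv_word_eq(1)[OF u(1)] by blast
    have "pres_class X R (inv_word u) \<otimes>\<^bsub>?P\<^esub> x = \<one>\<^bsub>?P\<^esub>"
      unfolding u(2) one mult_pres_class[OF inv_word_eq(1)[OF u(1)] u(1)] pres_class_eq_iff[OF v]
      by (rule inv_word_eq(2)[OF u(1)])
    then show ?thesis using in_car[OF inv_word_eq(1)[OF u(1)]] by blast
  qed
qed

lemma group_coxeter_group: "group (coxeter_group I m)"
  by (simp add: coxeter_group_def group_presented_group)

lemma group_building_Aut: "group (building_Aut B)"
proof -
  interpret S: group "BijGroup (chambers B)" by (rule group_BijGroup)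
  let ?A = "{g \<in> Bij (chambers B). \<forall>a\<in>chambers B. \<forall>b\<in>chambers B.
        ({g a, g b} \<in> edges B \<longleftrightarrow> {a, b} \<in> edges B) \<and>
        ({a, b} \<in> edges B \<longrightarrow> color B {g a, g b} = color B {a, b})}"
  have "subgroup ?A (BijGroup (chambers B))"
  proof (rule S.subgroupI)
    show "?A \<subseteq> carrier (BijGroup (chambers B))" by (auto simp: BijGroup_def)
    have "(\<lambda>x\<in>chambers B. x) \<in> ?A" by (simp add: id_Bij)
    then show "?A \<noteq> {}" by blast
  next
    fix g assume g: "g \<in> ?A"
    let ?h = "\<lambda>x\<in>chambers B. inv_into (chambers B) g x"
    have gb: "g ` chambers B = chambers B" "g \<in> Bij (chambers B)"
      using g by (auto simp: Bij_def bij_betw_def)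
    have 1: "?h a \<in> chambers B" "g (?h a) = a" if "a \<in> chambers B" for a
      using that gb by (simp_all add: inv_into_into f_inv_into_f)
    have "?h \<in> Bij (chambers B)" using gb by (rule_tac restrict_inv_into_Bij)
    moreover have "({?h a, ?h b} \<in> edges B \<longleftrightarrow> {a, b} \<in> edges B) \<and>
        ({a, b} \<in> edges B \<longrightarrow> color B {?h a, ?h b} = color B {a, b})"
      if "a \<in> chambers B" "b \<in> chambers B" for a b
    proof -
      have "({g (?h a), g (?h b)} \<in> edges B \<longleftrightarrow> {?h a, ?h b} \<in> edges B) \<and>
        ({?h a, ?h b} \<in> edges B \<longrightarrow> color B {g (?h a), g (?h b)} = color B {?h a, ?h b})"
        using g 1(1)[OF that(1)] 1(1)[OF that(2)] by blast
      then show ?thesis unfolding 1(2)[OF that(1)] 1(2)[OF that(2)] by metis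
    qed
    ultimately have "?h \<in> ?A" by blast
    then show "inv\<^bsub>BijGroup (chambers B)\<^esub> g \<in> ?A" using gb by (simp only: inv_BijGroup)
  next
    fix g h assume gh: "g \<in> ?A" "h \<in> ?A"
    have hC: "h a \<in> chambers B" if "a \<in> chambers B" for a
      using that gh(2) by (auto simp: Bij_def bij_betw_def)
    have "compose (chambers B) g h \<in> ?A"
      using gh hC by (simp add: compose_Bij) (simp add: compose_def)
    then show "g \<otimes>\<^bsub>BijGroup (chambers B)\<^esub> h \<in> ?A" using gh by (simp add: BijGroup_def)
  qed
  then show ?thesis
    unfolding building_Aut_def by (rule S.subgroup_imp_group)
qed

lemma istopology_weak:
  "istopology (\<lambda>U. U \<subseteq> realization \<Delta> \<and>
    (\<forall>a\<in>\<Delta>. closedin (top_of_set (simplex_realization a))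
      ((realization \<Delta> - U) \<inter> simplex_realization a)))"
  unfolding istopology_def
proof (intro conjI allI impI ballI)
  fix S T a
  assume S: "S \<subseteq> realization \<Delta> \<and> (\<forall>a\<in>\<Delta>. closedin (top_of_set (simplex_realization a))
      ((realization \<Delta> - S) \<inter> simplex_realization a))"
   and T: "T \<subseteq> realization \<Delta> \<and> (\<forall>a\<in>\<Delta>. closedin (top_of_set (simplex_realization a))
      ((realization \<Delta> - T) \<inter> simplex_realization a))" 
  show "S \<inter> T \<subseteq> realization \<Delta>" using S by blast
  assume "a \<in> \<Delta>"
  moreover have "(realization \<Delta> - S \<inter> T) \<inter> simplex_realization a =
    (realization \<Delta> - S) \<inter> simplex_realization a \<union> (realization \<Delta> - T) \<inter> simplex_realization a" by blast
  ultimately show "closedin (top_of_set (simplex_realization a))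
      ((realization \<Delta> - S \<inter> T) \<inter> simplex_realization a)"
    using S T by (metis closedin_Un)
next
  fix \<K> assume K: "\<forall>S\<in>\<K>. S \<subseteq> realization \<Delta> \<and> (\<forall>a\<in>\<Delta>. closedin (top_of_set (simplex_realization a))
      ((realization \<Delta> - S) \<inter> simplex_realization a))"
  show "\<Union>\<K> \<subseteq> realization \<Delta>" using K by blast
  fix a assume a: "a \<in> \<Delta>"
  then have sub: "simplex_realization a \<subseteq> realization \<Delta>" by (auto simp: realization_def)
  show "closedin (top_of_set (simplex_realization a)) ((realization \<Delta> - \<Union>\<K>) \<inter> simplex_realization a)"
  proof (cases "\<K> = {}")
    case True
    then show ?thesis using sub by (simp add: Int_absorb1)
  next
    case False
    then have "(realization \<Delta> - \<Union>\<K>) \<inter> simplex_realization a =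
      (\<Inter>S\<in>\<K>. (realization \<Delta> - S) \<inter> simplex_realization a)" by blast
    moreover have "closedin (top_of_set (simplex_realization a)) (\<Inter>S\<in>\<K>. (realization \<Delta> - S) \<inter> simplex_realization a)"
      using False K a by (intro closedin_INT) auto
    ultimately show ?thesis by simp
  qed
qed

lemma topspace_weak_topology: "topspace (weak_topology \<Delta>) = realization \<Delta>"
proof -
  have "openin (weak_topology \<Delta>) (realization \<Delta>)"
    unfolding weak_topology_def topology_inverse'[OF istopology_weak] by simp
  moreover have "U \<subseteq> realization \<Delta>" if "openin (weak_topology \<Delta>) U" for U
    using that unfolding weak_topology_def topology_inverse'[OF istopology_weak] by simp
  ultimately show ?thesis by (metis openin_subset openin_topspace subset_antisym)
qed

lemma closedin_weak_topology:
  "closedin (weak_topology \<Delta>) A \<longleftrightarrow> A \<subseteq> realization \<Delta> \<and>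
    (\<forall>a\<in>\<Delta>. closedin (top_of_set (simplex_realization a)) (A \<inter> simplex_realization a))"
  unfolding closedin_def[of "weak_topology \<Delta>"] topspace_weak_topology
  unfolding weak_topology_def topology_inverse'[OF istopology_weak]
  by (auto simp: double_diff)

lemma abstract_complex_davis_complex:
  fixes I :: "'i set" and m :: "'i \<Rightarrow> 'i \<Rightarrow> enat" and B :: "('c, 'i) building_data"
  shows "abstract_complex (spherical_residues I m B) (davis_complex I m B)"
proof -
  have last_max: "J \<subseteq> last Js" if "sorted_wrt (\<subseteq>) Js" "J \<in> set Js" for J and Js :: "'i set list"
    using that by (induction Js) (auto split: if_splits)
  have mono: "finite (parabolic I m J)" if "finite (parabolic I m K)" "J \<subseteq> K" for J K
    using that unfolding parabolic_def
    by (meson finite_subset group.mono_generate group_coxeter_group image_mono)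
  have sub: "b \<in> davis_complex I m B" if "a \<in> davis_complex I m B" "b \<subseteq> a" for a b
  proof (cases "b = {}")
    case True then show ?thesis by (simp add: davis_complex_def)
  next
    case False
    then have "a \<noteq> {}" using that(2) by blast
    with that(1) obtain Js c where *: "a = (\<lambda>J. residue B J c) ` set Js" "c \<in> chambers B" "set Js \<subseteq> Pow I"
      "sorted_wrt (\<subseteq>) Js" "finite (parabolic I m (last Js))"
      by (auto simp: davis_complex_def)
    define Ks where "Ks = filter (\<lambda>J. residue B J c \<in> b) Js"
    have b: "b = (\<lambda>J. residue B J c) ` set Ks"
      using that(2) * by (auto simp: Ks_def)
    then have ne: "Ks \<noteq> []" using False by auto
    then have "last Ks \<in> set Js" using last_in_set[OF ne] by (auto simp: Ks_def)
    then have "finite (parabolic I m (last Ks))"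
      by (rule mono[OF *(5) last_max[OF *(4)]])
    moreover have "sorted_wrt (\<subseteq>) Ks" "set Ks \<subseteq> Pow I" using * by (auto simp: Ks_def sorted_wrt_filter)
    ultimately show ?thesis using b ne *(2)
      unfolding davis_complex_def by (intro insertI2 CollectI exI[of _ Ks] exI[of _ c]) auto
  qed
  have "\<Union>(davis_complex I m B) = spherical_residues I m B"
  proof (intro subset_antisym subsetI)
    fix R assume "R \<in> \<Union>(davis_complex I m B)"
    then obtain Js c J where *: "c \<in> chambers B" "set Js \<subseteq> Pow I" "J \<in> set Js" "R = residue B J c"
      "sorted_wrt (\<subseteq>) Js" "finite (parabolic I m (last Js))"
      by (auto simp: davis_complex_def)
    then show "R \<in> spherical_residues I m B"
      using mono[OF *(6) last_max[OF *(5,3)]] unfolding spherical_residues_def by blast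
  next
    fix R assume "R \<in> spherical_residues I m B"
    then obtain J c where *: "c \<in> chambers B" "J \<subseteq> I" "R = residue B J c" "finite (parabolic I m J)"
      by (auto simp: spherical_residues_def)
    then have "(\<lambda>J. residue B J c) ` set [J] \<in> davis_complex I m B"
      unfolding davis_complex_def by (intro insertI2 CollectI exI[of _ "[J]"] exI[of _ c]) auto
    with * show "R \<in> \<Union>(davis_complex I m B)" by auto
  qed
  moreover have "finite a" if "a \<in> davis_complex I m B" for a
    using that by (auto simp: davis_complex_def)
  ultimately show ?thesis using sub unfolding abstract_complex_def by blast
qed

end

theory Submission
  imports Defs
begin

text \<open>
  The whole proposition rests on one observation: a point of a geometric realization lies in
  a finite simplex, and an automorphism acts linearly on that simplex. What an automorphism
  does to the point is therefore decided by what it does to finitely many vertices, and what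
  it does to a vertex \<open>Res\<^sub>J(c)\<close> is decided by what it does to the single chamber \<open>c\<close>.

  In the topology of pointwise convergence on a discrete set, the automorphisms that agree
  with a given one at finitely many places form a basis of neighbourhoods
  (\<open>openin_pointwise_topology_discrete\<close>). Hence every map on the group that depends only on the
  values at finitely many places is locally constant, and so continuous into any space at all
  (\<open>continuous_map_if_finitely_determined\<close>). This gives the comparison of chambers with
  residues, and shows that pointwise convergence on vertices is at least as fine as pointwise
  convergence on the realization, whatever the topology there. Conversely the
  action on vertices can be read off from the action on the realization as soon as the vertices
  form a discrete subset.

  The compact-open topology needs one more fact: a compact set for the weak topology meets the
  interiors of only finitely many simplices (\<open>finite_support_of_compactin_weak_topology\<close>), so
  the behaviour on a compact set is again decided by finitely many vertices.

  Joint continuity at \<open>(h, x)\<close> uses the same neighbourhoods of \<open>h\<close>. If \<open>x\<close> has a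
  neighbourhood inside a finite subcomplex, then all \<open>g\<close> near \<open>h\<close> act on it exactly like
  \<open>h\<close>, and \<open>h\<close> is continuous. If the action is isometric, then \<open>g x = h x\<close> for \<open>g\<close> near \<open>h\<close>,
  so that the distance from \<open>g y\<close> to \<open>h x\<close> is the distance from \<open>y\<close> to \<open>x\<close>.

  Buildings enter only through the action on residues: automorphisms act simplicially, and
  residues reduce to chambers (\<open>automorphism_image_residue\<close>). The rest concerns sets of
  simplicial self-maps of a simplicial complex, the locale \<open>simplicial_action\<close>.
\<close>

section \<open>Pointwise convergence\<close>

definition agreeing_with :: "'g set \<Rightarrow> ('g \<Rightarrow> 'x \<Rightarrow> 'y) \<Rightarrow> 'g \<Rightarrow> 'x set \<Rightarrow> 'g set" where
  "agreeing_with G act h F = {g \<in> G. \<forall>x\<in>F. act g x = act h x}"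

lemma topspace_pointwise_topology:
  assumes "act \<in> G \<rightarrow> topspace T \<rightarrow> topspace T"
  shows "topspace (pointwise_topology G act T) = G"
  using assms unfolding pointwise_topology_def topspace_pullback_topology by fastforce

lemma continuous_map_into_pointwise_topology:
  assumes "f \<in> topspace Y \<rightarrow> G"
    and "\<And>x. x \<in> topspace T \<Longrightarrow> continuous_map Y T (\<lambda>y. act (f y) x)"
  shows "continuous_map Y (pointwise_topology G act T) f"
  unfolding pointwise_topology_def
proof (rule continuous_map_pullback')
  show "continuous_map Y (product_topology (\<lambda>_. T) (topspace T)) ((\<lambda>g. restrict (act g) (topspace T)) \<circ> f)"
    using assms(2) by (auto simp: continuous_map_componentwise)
  show "topspace Y \<subseteq> f -` G" using assms(1) by auto
qed

lemma continuous_map_evaluation: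
  assumes "x \<in> topspace T"
  shows "continuous_map (pointwise_topology G act T) T (\<lambda>g. act g x)"
proof -
  have "continuous_map (pointwise_topology G act T) T ((\<lambda>k. k x) \<circ> (\<lambda>g. restrict (act g) (topspace T)))"
    unfolding pointwise_topology_def
    by (rule continuous_map_pullback[OF continuous_map_product_projection[OF assms]])
  then show ?thesis using assms by (simp add: o_def)
qed

lemma topology_eq_if_continuous_id:
  assumes "topspace S = topspace T" "continuous_map S T (\<lambda>x. x)" "continuous_map T S (\<lambda>x. x)"
  shows "S = T"
  using assms topology_finer_continuous_id[of S T] topology_finer_continuous_id[of T S]
  unfolding topology_eq id_def by auto

text \<open>
  A basic open set of the product restricts only finitely many coordinates, and over a discrete
  space the strongest restriction of a coordinate is to prescribe its value.
\<close>

lemma openin_pointwise_topology_discrete: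
  assumes act: "act \<in> G \<rightarrow> S \<rightarrow> S"
  shows "openin (pointwise_topology G act (discrete_topology S)) U \<longleftrightarrow>
    U \<subseteq> G \<and> (\<forall>h\<in>U. \<exists>F. finite F \<and> F \<subseteq> S \<and> agreeing_with G act h F \<subseteq> U)"
    (is "openin ?T U \<longleftrightarrow> ?R")
proof
  have top: "topspace ?T = G"
    by (rule topspace_pointwise_topology) (use act in simp)
  show ?R if U: "openin ?T U"
  proof (intro conjI ballI)
    show "U \<subseteq> G" using openin_subset[OF U] top by simp
    fix h assume h: "h \<in> U"
    from U obtain W where W: "openin (product_topology (\<lambda>_. discrete_topology S) S) W"
      and UW: "U = (\<lambda>g. restrict (act g) S) -` W \<inter> G"
      unfolding pointwise_topology_def openin_pullback_topology by auto
    from W h obtain N where N: "finite {x \<in> S. N x \<noteq> S}" "restrict (act h) S \<in> Pi\<^sub>E S N"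
      "Pi\<^sub>E S N \<subseteq> W"
      unfolding openin_product_topology_alt UW by fastforce
    have "agreeing_with G act h {x \<in> S. N x \<noteq> S} \<subseteq> U"
    proof
      fix g assume "g \<in> agreeing_with G act h {x \<in> S. N x \<noteq> S}"
      then have g: "g \<in> G" "\<And>x. x \<in> S \<Longrightarrow> N x \<noteq> S \<Longrightarrow> act g x = act h x"
        by (auto simp: agreeing_with_def)
      have "act g x \<in> N x" if "x \<in> S" for x
      proof (cases "N x = S")
        case True then show ?thesis using act g(1) that by auto
      next
        case False
        then have "act g x = act h x" using g(2) that by blast
        then show ?thesis using N(2) that by (auto simp: PiE_iff)
      qed
      then have "restrict (act g) S \<in> Pi\<^sub>E S N" by (simp add: PiE_iff)
      then show "g \<in> U" using N(3) g(1) unfolding UW by blast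
    qed
    with N(1) show "\<exists>F. finite F \<and> F \<subseteq> S \<and> agreeing_with G act h F \<subseteq> U" by blast
  qed
  show "openin ?T U" if R: ?R
  proof (subst openin_subopen, intro ballI)
    fix h assume h: "h \<in> U"
    then obtain F where F: "finite F" "F \<subseteq> S" "agreeing_with G act h F \<subseteq> U" "h \<in> G"
      using R by blast
    have "openin ?T {g \<in> topspace ?T. act g x \<in> {act h x}}" if "x \<in> F" for x
    proof (rule openin_continuous_map_preimage[OF continuous_map_evaluation])
      show "x \<in> topspace (discrete_topology S)" using that F by auto
      show "openin (discrete_topology S) {act h x}" using act F(2,4) that by auto
    qed
    then have "openin ?T ((\<Inter>x\<in>F. {g \<in> topspace ?T. act g x \<in> {act h x}}) \<inter> topspace ?T)"
      by (rule openin_INT[OF F(1)])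
    moreover have "(\<Inter>x\<in>F. {g \<in> topspace ?T. act g x \<in> {act h x}}) \<inter> topspace ?T = agreeing_with G act h F"
      by (auto simp: top agreeing_with_def)
    ultimately have "openin ?T (agreeing_with G act h F)" by simp
    then show "\<exists>W. openin ?T W \<and> h \<in> W \<and> W \<subseteq> U"
      using F by (auto simp: agreeing_with_def)
  qed
qed

lemma openin_agreeing_with:
  assumes "act \<in> G \<rightarrow> S \<rightarrow> S" "finite F" "F \<subseteq> S"
  shows "openin (pointwise_topology G act (discrete_topology S)) (agreeing_with G act h F)"
  unfolding openin_pointwise_topology_discrete[OF assms(1)]
  using assms(2,3) by (force simp: agreeing_with_def)

text \<open>
  The map is constant on the open sets of transformations that agree on \<open>F\<close>, hence
  continuous into every topology on its target. This is what allows arbitrary topologies on a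
  realization.
\<close>

lemma continuous_map_if_finitely_determined:
  assumes act: "act \<in> G \<rightarrow> S \<rightarrow> S"
    and f: "f \<in> G \<rightarrow> topspace T"
    and F: "finite F" "F \<subseteq> S"
    and det: "\<And>g h. g \<in> G \<Longrightarrow> h \<in> G \<Longrightarrow> (\<And>x. x \<in> F \<Longrightarrow> act g x = act h x) \<Longrightarrow> f g = f h"
  shows "continuous_map (pointwise_topology G act (discrete_topology S)) T f"
proof -
  have top: "topspace (pointwise_topology G act (discrete_topology S)) = G"
    by (rule topspace_pointwise_topology) (use act in simp)
  have "agreeing_with G act h F \<subseteq> {g \<in> G. f g \<in> U}" if "h \<in> G" "f h \<in> U" for h U
    using det[OF _ that(1)] that(2) by (auto simp: agreeing_with_def)
  then have "openin (pointwise_topology G act (discrete_topology S)) {g \<in> G. f g \<in> U}" for U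
    unfolding openin_pointwise_topology_discrete[OF act] using F by (blast intro: exI[of _ F])
  then show ?thesis unfolding continuous_map_def top using f by auto
qed

text \<open>
  Points are compact, so the compact-open topology is finer than pointwise convergence. Its
  generating sets cover \<open>G\<close> because the empty set is compact and open.
\<close>

lemma continuous_map_compact_open_pointwise:
  assumes act: "act \<in> G \<rightarrow> topspace T \<rightarrow> topspace T"
  shows "topspace (compact_open_topology G act T) = G"
    and "continuous_map (compact_open_topology G act T) (pointwise_topology G act T) (\<lambda>g. g)"
proof -
  have "{g \<in> G. act g ` {} \<subseteq> {}} \<in> {{g \<in> G. act g ` K \<subseteq> U} | K U. compactin T K \<and> openin T U}"
    by (rule CollectI, intro exI[of _ "{}"]) auto
  then show top: "topspace (compact_open_topology G act T) = G"
    unfolding compact_open_topology_def topology_generated_by_topspace by auto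
  show "continuous_map (compact_open_topology G act T) (pointwise_topology G act T) (\<lambda>g. g)"
  proof (rule continuous_map_into_pointwise_topology)
    show "(\<lambda>g. g) \<in> topspace (compact_open_topology G act T) \<rightarrow> G" by (simp add: top)
    fix x assume x: "x \<in> topspace T"
    have "openin (compact_open_topology G act T) {g \<in> G. act g x \<in> U}" if "openin T U" for U
      unfolding compact_open_topology_def
    proof (rule topology_generated_by_Basis)
      have "{g \<in> G. act g x \<in> U} = {g \<in> G. act g ` {x} \<subseteq> U}" by auto
      then show "{g \<in> G. act g x \<in> U} \<in> {{g \<in> G. act g ` K \<subseteq> U} | K U. compactin T K \<and> openin T U}"
        using that x by (intro CollectI exI[of _ "{x}"] exI[of _ U]) auto
    qed
    then show "continuous_map (compact_open_topology G act T) T (\<lambda>g. act g x)"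
      unfolding continuous_map_def top using act x by auto
  qed
qed

section \<open>Geometric realizations and the weak topology\<close>

lemma linear_extension_cong:
  assumes "\<And>v. x v \<noteq> 0 \<Longrightarrow> f v = g v"
  shows "linear_extension f x = linear_extension g x"
  unfolding linear_extension_def using assms by (auto intro!: ext sum.cong)

lemma linear_extension_vertex_point: "linear_extension f (vertex_point v) = vertex_point (f v)"
proof
  fix w
  have "{u. vertex_point v u \<noteq> 0 \<and> f u = w} = (if f v = w then {v} else {})"
    by (auto simp: vertex_point_def indicator_def)
  then show "linear_extension f (vertex_point v) w = vertex_point (f v) w"
    by (auto simp: linear_extension_def vertex_point_def)
qed

lemma inj_vertex_point: "inj vertex_point"
  by (rule injI) (metis indicator_simps singleton_iff vertex_point_def zero_neq_one)

text \<open>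
  Each coordinate of the image collects the coordinates of \<open>x\<close> over one fibre of \<open>f\<close>. As the
  fibres partition the simplex, the total stays 1, even when \<open>f\<close> is not injective on it.
\<close>

lemma linear_extension_in_simplex_realization:
  assumes a: "finite a" and x: "x \<in> simplex_realization a"
  shows "linear_extension f x \<in> simplex_realization (f ` a)"
proof -
  have x0: "0 \<le> x v" and xa: "v \<notin> a \<Longrightarrow> x v = 0" and x1: "sum x a = 1" for v
    using x by (auto simp: simplex_realization_def)
  have eq: "linear_extension f x w = (\<Sum>v | v \<in> a \<and> f v = w. x v)" for w
    unfolding linear_extension_def
    by (rule sum.mono_neutral_left) (use a xa in auto)
  have "(\<Sum>w\<in>f ` a. linear_extension f x w) = 1"
    unfolding eq using sum.group[of a "f ` a" f x] a x1 by simp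
  moreover have "linear_extension f x w = 0" if "w \<notin> f ` a" for w
    unfolding eq using that by (intro sum.neutral) auto
  ultimately show ?thesis
    unfolding simplex_realization_def using x0 by (auto simp: eq intro!: sum_nonneg)
qed

lemma support_in_complex:
  assumes "abstract_complex V \<Delta>" "x \<in> realization \<Delta>"
  shows "{v. x v \<noteq> 0} \<in> \<Delta>" "finite {v. x v \<noteq> 0}" "{v. x v \<noteq> 0} \<subseteq> V"
proof -
  obtain a where a: "a \<in> \<Delta>" "x \<in> simplex_realization a"
    using assms(2) by (auto simp: realization_def)
  then have "{v. x v \<noteq> 0} \<subseteq> a" by (auto simp: simplex_realization_def)
  then show "{v. x v \<noteq> 0} \<in> \<Delta>" using a assms(1) unfolding abstract_complex_def by blast
  then show "finite {v. x v \<noteq> 0}" "{v. x v \<noteq> 0} \<subseteq> V"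
    using assms(1) unfolding abstract_complex_def by blast+
qed

lemma vertex_point_in_realization:
  assumes "abstract_complex V \<Delta>" "v \<in> V"
  shows "vertex_point v \<in> realization \<Delta>"
proof -
  have "{v} \<in> \<Delta>" using assms unfolding abstract_complex_def by blast
  moreover have "vertex_point v \<in> simplex_realization {v}"
    by (auto simp: vertex_point_def simplex_realization_def)
  ultimately show ?thesis by (auto simp: realization_def)
qed

text \<open>
  Closed simplices are \<open>T\<^sub>1\<close>, being subspaces of a product of Hausdorff spaces, so finite subsets
  of them are closed.
\<close>

lemma closedin_weak_topology_if_finite_on_simplices:
  assumes "A \<subseteq> realization \<Delta>" "\<And>a. a \<in> \<Delta> \<Longrightarrow> finite (A \<inter> simplex_realization a)"
  shows "closedin (weak_topology \<Delta>) A"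
  unfolding closedin_weak_topology
proof (intro conjI ballI assms(1))
  fix a assume "a \<in> \<Delta>"
  moreover have "t1_space (top_of_set (simplex_realization a))"
    by (intro Hausdorff_imp_t1_space Hausdorff_space_subtopology)
      (simp add: Hausdorff_space_product_topology flip: euclidean_product_topology)
  ultimately show "closedin (top_of_set (simplex_realization a)) (A \<inter> simplex_realization a)"
    using assms(2) by (simp add: t1_space_closedin_finite)
qed

lemma discrete_subset_if_all_subsets_closed:
  assumes "\<And>A. A \<subseteq> S \<Longrightarrow> closedin T A"
  shows "discrete_subset T S"
  unfolding discrete_subset_def
proof
  show S: "S \<subseteq> topspace T" using assms[of S] closedin_subset by blast
  have "closedin (subtopology T S) (S - A)" if "A \<subseteq> S" for A
    by (rule closedin_subset_topspace) (use assms in auto)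
  then have "openin (subtopology T S) A" if "A \<subseteq> S" for A
    using that S by (simp add: openin_closedin_eq inf_absorb2)
  then show "subtopology T S = discrete_topology S"
    using S by (metis discrete_topology_unique topspace_subtopology_subset openin_subset
        subset_refl singletonD insert_subset empty_subsetI)
qed

text \<open>
  A simplex contains only finitely many vertices, so every set of vertices is closed.
\<close>

lemma discrete_subset_vertices_weak_topology:
  assumes "abstract_complex V \<Delta>"
  shows "discrete_subset (weak_topology \<Delta>) (vertex_point ` V)"
proof (rule discrete_subset_if_all_subsets_closed, rule closedin_weak_topology_if_finite_on_simplices)
  fix A assume A: "A \<subseteq> vertex_point ` V"
  then show "A \<subseteq> realization \<Delta>" using vertex_point_in_realization[OF assms] by blast
  fix a assume "a \<in> \<Delta>"
  then have "finite a" using assms by (auto simp: abstract_complex_def)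
  moreover have "A \<inter> simplex_realization a \<subseteq> vertex_point ` a"
    using A by (force simp: simplex_realization_def vertex_point_def indicator_def)
  ultimately show "finite (A \<inter> simplex_realization a)" by (meson finite_imageI finite_subset)
qed

lemma finite_if_compactin_discrete:
  assumes K: "compactin T K" and S: "S \<subseteq> K" "\<And>A. A \<subseteq> S \<Longrightarrow> closedin T A"
  shows "finite S"
proof -
  have "compactin T S" using closed_compactin[OF K S(1)] S(2) by blast
  then have "compact_space (subtopology T S)" by (simp add: compactin_subspace)
  then show ?thesis
    using discrete_subset_if_all_subsets_closed[of S T] S(2)
    by (simp add: discrete_subset_def compact_space_discrete_topology)
qed

text \<open>
  Choose one point of \<open>K\<close> for each support that occurs in \<open>K\<close>. A simplex has finitely many faces
  and hence contains finitely many of the chosen points. So all sets of chosen points are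
  closed; by compactness there are finitely many of them, and finitely many supports.
\<close>

lemma finite_support_of_compactin_weak_topology:
  assumes \<Delta>: "abstract_complex V \<Delta>" and K: "compactin (weak_topology \<Delta>) K"
  shows "finite (\<Union>x\<in>K. {v. x v \<noteq> 0})"
proof -
  let ?supp = "\<lambda>x. {v. x v \<noteq> (0::real)}"
  have KX: "K \<subseteq> realization \<Delta>"
    using compactin_subset_topspace[OF K] by (simp add: topspace_weak_topology)
  obtain S where S: "S \<subseteq> K" "inj_on ?supp S" "?supp ` S = ?supp ` K"
    using subset_image_inj[of "?supp ` K" ?supp K] by auto
  have "finite S"
  proof (rule finite_if_compactin_discrete[OF K S(1)], rule closedin_weak_topology_if_finite_on_simplices)
    fix A assume A: "A \<subseteq> S"
    then show "A \<subseteq> realization \<Delta>" using S(1) KX by blast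
    fix a assume "a \<in> \<Delta>"
    then have "finite a" using \<Delta> by (auto simp: abstract_complex_def)
    moreover have "?supp ` (A \<inter> simplex_realization a) \<subseteq> Pow a"
      by (auto simp: simplex_realization_def)
    ultimately have "finite (?supp ` (A \<inter> simplex_realization a))" 
      by (meson finite_Pow_iff finite_subset)
    then show "finite (A \<inter> simplex_realization a)"
      by (rule finite_imageD) (use S(2) A in \<open>auto intro: inj_on_subset\<close>)
  qed
  then have "finite (?supp ` K)" using S(3) by (metis finite_imageI)
  moreover have "finite (?supp x)" if "x \<in> K" for x
    using support_in_complex(2)[OF \<Delta>] that KX by blast
  ultimately show ?thesis by blast
qed

section \<open>Simplicial actions on geometric realizations\<close>

locale simplicial_action =
  fixes G :: "'g set" and \<rho> :: "'g \<Rightarrow> 'v \<Rightarrow> 'v" and V :: "'v set" and \<Delta> :: "'v set set"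
  assumes complex: "abstract_complex V \<Delta>"
    and simplicial: "\<And>g a. g \<in> G \<Longrightarrow> a \<in> \<Delta> \<Longrightarrow> \<rho> g ` a \<in> \<Delta>"
begin

abbreviation act :: "'g \<Rightarrow> ('v \<Rightarrow> real) \<Rightarrow> 'v \<Rightarrow> real" where
  "act g \<equiv> linear_extension (\<rho> g)"

abbreviation vertex_topology :: "'g topology" where
  "vertex_topology \<equiv> pointwise_topology G \<rho> (discrete_topology V)"

lemma vertex_closed: "\<rho> \<in> G \<rightarrow> V \<rightarrow> V"
  using complex simplicial unfolding abstract_complex_def by blast

lemma act_closed: "act \<in> G \<rightarrow> realization \<Delta> \<rightarrow> realization \<Delta>"
  using linear_extension_in_simplex_realization simplicial complex
  unfolding realization_def abstract_complex_def by (fastforce intro!: Pi_I)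

lemma topspace_vertex_topology: "topspace vertex_topology = G"
  by (rule topspace_pointwise_topology) (use vertex_closed in simp)

text \<open>
  The support of a point is the vertex set of the smallest simplex containing it. Agreement on
  these finitely many vertices is what every neighbourhood below is built from.
\<close>

lemma act_eq_if_agree_on_support:
  assumes "g \<in> agreeing_with G \<rho> h F" "{v. x v \<noteq> 0} \<subseteq> F"
  shows "act g x = act h x"
  by (rule linear_extension_cong) (use assms in \<open>auto simp: agreeing_with_def\<close>)

text \<open>
  Evaluation at a point depends only on the images of the vertices in its support, which makes it
  continuous for pointwise convergence on vertices. Discreteness of the vertices serves the
  converse: evaluation at a vertex then takes values in a discrete space.
\<close>

theorem pointwise_topology_realization:
  assumes T: "topspace T = realization \<Delta>" and disc: "discrete_subset T (vertex_point ` V)"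
  shows "pointwise_topology G act T = vertex_topology"
proof (rule topology_eq_if_continuous_id)
  show top: "topspace (pointwise_topology G act T) = topspace vertex_topology"
    unfolding topspace_vertex_topology
    by (rule topspace_pointwise_topology) (use act_closed T in simp)
  show "continuous_map vertex_topology (pointwise_topology G act T) (\<lambda>g. g)"
  proof (rule continuous_map_into_pointwise_topology)
    fix x assume x: "x \<in> topspace T"
    note supp = support_in_complex[OF complex x[unfolded T]]
    show "continuous_map vertex_topology T (\<lambda>g. act g x)"
    proof (rule continuous_map_if_finitely_determined[OF vertex_closed _ supp(2,3)])
      show "(\<lambda>g. act g x) \<in> G \<rightarrow> topspace T" using act_closed x T by auto
      show "act g x = act h x" if "\<And>v. v \<in> {v. x v \<noteq> 0} \<Longrightarrow> \<rho> g v = \<rho> h v" for g h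
        using that by (intro linear_extension_cong) auto
    qed
  qed (simp add: topspace_vertex_topology)
  show "continuous_map (pointwise_topology G act T) vertex_topology (\<lambda>g. g)"
  proof (rule continuous_map_into_pointwise_topology)
    fix v assume "v \<in> topspace (discrete_topology V)"
    then have v: "v \<in> V" by simp
    have "continuous_map (pointwise_topology G act T) T (\<lambda>g. act g (vertex_point v))"
      by (rule continuous_map_evaluation) (simp add: T vertex_point_in_realization[OF complex v])
    then have "continuous_map (pointwise_topology G act T) T (\<lambda>g. vertex_point (\<rho> g v))"
      by (simp add: linear_extension_vertex_point)
    moreover have "vertex_point (\<rho> g v) \<in> vertex_point ` V" if "g \<in> G" for g
      using vertex_closed that v by auto
    ultimately have "continuous_map (pointwise_topology G act T) (subtopology T (vertex_point ` V))
        (\<lambda>g. vertex_point (\<rho> g v))"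
      by (auto simp: continuous_map_in_subtopology top topspace_vertex_topology)
    then have "continuous_map (pointwise_topology G act T) (discrete_topology (vertex_point ` V))
        (\<lambda>g. vertex_point (\<rho> g v))"
      using disc by (simp add: discrete_subset_def)
    moreover have "continuous_map (discrete_topology (vertex_point ` V)) (discrete_topology V) (the_inv vertex_point)"
      by (auto simp: the_inv_f_f[OF inj_vertex_point])
    ultimately have "continuous_map (pointwise_topology G act T) (discrete_topology V)
        (the_inv vertex_point \<circ> (\<lambda>g. vertex_point (\<rho> g v)))"
      by (rule continuous_map_compose)
    then show "continuous_map (pointwise_topology G act T) (discrete_topology V) (\<lambda>g. \<rho> g v)"
      by (simp add: o_def the_inv_f_f[OF inj_vertex_point])
  qed (simp add: top topspace_vertex_topology)
qed

text \<open>
  One direction holds because the compact-open topology refines pointwise convergence and the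
  vertices are discrete in the weak topology. For the other, the supports of the points of a
  compact set have finite union, so a transformation that agrees with \<open>h\<close> on this union moves
  the compact set exactly as \<open>h\<close> does.
\<close>

theorem compact_open_topology_realization:
  "compact_open_topology G act (weak_topology \<Delta>) = vertex_topology"
proof (rule topology_eq_if_continuous_id)
  let ?CO = "compact_open_topology G act (weak_topology \<Delta>)"
  have act: "act \<in> G \<rightarrow> topspace (weak_topology \<Delta>) \<rightarrow> topspace (weak_topology \<Delta>)"
    using act_closed by (simp add: topspace_weak_topology)
  note co = continuous_map_compact_open_pointwise[OF act]
  show "topspace ?CO = topspace vertex_topology"
    using co(1) by (simp add: topspace_vertex_topology)
  show "continuous_map ?CO vertex_topology (\<lambda>g. g)"
    using co(2) pointwise_topology_realization[OF topspace_weak_topology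
        discrete_subset_vertices_weak_topology[OF complex]] by simp
  show "continuous_map vertex_topology ?CO (\<lambda>g. g)"
    unfolding compact_open_topology_def
  proof (rule continuous_on_generated_topo)
    show "(\<lambda>g. g) ` topspace vertex_topology
        \<subseteq> \<Union> {{g \<in> G. act g ` K \<subseteq> U} | K U. compactin (weak_topology \<Delta>) K \<and> openin (weak_topology \<Delta>) U}"
      using co(1) unfolding compact_open_topology_def topology_generated_by_topspace
      by (simp add: topspace_vertex_topology)
    fix N assume "N \<in> {{g \<in> G. act g ` K \<subseteq> U} | K U. compactin (weak_topology \<Delta>) K \<and> openin (weak_topology \<Delta>) U}"
    then obtain K U where K: "compactin (weak_topology \<Delta>) K" and N: "N = {g \<in> G. act g ` K \<subseteq> U}"
      by blast
    have KX: "K \<subseteq> realization \<Delta>"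
      using compactin_subset_topspace[OF K] by (simp add: topspace_weak_topology)
    let ?F = "\<Union>x\<in>K. {v. x v \<noteq> 0}"
    have F: "finite ?F" "?F \<subseteq> V"
      using finite_support_of_compactin_weak_topology[OF complex K] support_in_complex(3)[OF complex] KX
      by blast+
    have "agreeing_with G \<rho> h ?F \<subseteq> N" if "h \<in> N" for h
    proof
      fix g assume g: "g \<in> agreeing_with G \<rho> h ?F"
      have "act g x = act h x" if "x \<in> K" for x
        by (rule act_eq_if_agree_on_support[OF g]) (use that in blast)
      then show "g \<in> N" using that g by (auto simp: N agreeing_with_def)
    qed
    then have "openin vertex_topology N"
      unfolding openin_pointwise_topology_discrete[OF vertex_closed] using F N by blast
    moreover have "(\<lambda>g. g) -` N \<inter> topspace vertex_topology = N"
      using N by (auto simp: topspace_vertex_topology)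
    ultimately show "openin vertex_topology ((\<lambda>g. g) -` N \<inter> topspace vertex_topology)" by simp
  qed
qed

text \<open>
  Neighbourhoods of \<open>h\<close> may be taken of the form \<open>agreeing_with G \<rho> h F\<close>, so joint continuity
  amounts to finding \<open>F\<close> and a neighbourhood of \<open>x\<close> for every target neighbourhood of \<open>h x\<close>.
\<close>

lemma continuous_map_joint_evaluationI:
  assumes T: "topspace T = realization \<Delta>"
    and nbhd: "\<And>h x W. h \<in> G \<Longrightarrow> x \<in> realization \<Delta> \<Longrightarrow> openin T W \<Longrightarrow> act h x \<in> W \<Longrightarrow>
      \<exists>F U. finite F \<and> F \<subseteq> V \<and> openin T U \<and> x \<in> U \<and>
        (\<forall>g\<in>agreeing_with G \<rho> h F. \<forall>y\<in>U. act g y \<in> W)"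
  shows "continuous_map (prod_topology vertex_topology T) T (\<lambda>(g, x). act g x)"
  unfolding continuous_map_def
proof (intro conjI allI impI)
  show "(\<lambda>(g, x). act g x) \<in> topspace (prod_topology vertex_topology T) \<rightarrow> topspace T"
    using act_closed by (auto simp: topspace_vertex_topology T)
  fix W assume W: "openin T W"
  let ?P = "{z \<in> topspace (prod_topology vertex_topology T). (case z of (g, x) \<Rightarrow> act g x) \<in> W}"
  show "openin (prod_topology vertex_topology T) ?P"
    unfolding openin_prod_topology_alt
  proof (intro allI impI)
    fix h x assume "(h, x) \<in> ?P"
    then have h: "h \<in> G" and x: "x \<in> realization \<Delta>" and hx: "act h x \<in> W"
      by (auto simp: topspace_vertex_topology T)
    obtain F U where F: "finite F" "F \<subseteq> V" and U: "openin T U" "x \<in> U"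
      and FU: "\<forall>g\<in>agreeing_with G \<rho> h F. \<forall>y\<in>U. act g y \<in> W"
      using nbhd[OF h x W hx] by blast
    have "agreeing_with G \<rho> h F \<times> U \<subseteq> ?P"
      using FU openin_subset[OF U(1)] by (auto simp: topspace_vertex_topology agreeing_with_def)
    moreover have "h \<in> agreeing_with G \<rho> h F" using h by (simp add: agreeing_with_def)
    ultimately show "\<exists>N U. openin vertex_topology N \<and> openin T U \<and> h \<in> N \<and> x \<in> U \<and> N \<times> U \<subseteq> ?P"
      using openin_agreeing_with[OF vertex_closed F] U by blast
  qed
qed

text \<open>
  With \<open>U\<close> inside a finite subcomplex, every \<open>g\<close> that agrees with \<open>h\<close> on its vertices equals
  \<open>h\<close> on all of \<open>U\<close>. It remains to shrink \<open>U\<close> by continuity of \<open>h\<close> alone.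
\<close>

theorem continuous_map_joint_evaluation_locally_finite:
  assumes T: "topspace T = realization \<Delta>"
    and cont: "\<And>g. g \<in> G \<Longrightarrow> continuous_map T T (act g)"
    and lf: "locally_finite_topology \<Delta> T"
  shows "continuous_map (prod_topology vertex_topology T) T (\<lambda>(g, x). act g x)"
proof (rule continuous_map_joint_evaluationI[OF T])
  fix h x W assume h: "h \<in> G" and x: "x \<in> realization \<Delta>" and W: "openin T W" "act h x \<in> W"
  obtain U F where U: "openin T U" "x \<in> U" and F: "finite_subcomplex F \<Delta>" "U \<subseteq> realization F"
    using lf x unfolding locally_finite_topology_def by blast
  have F': "finite F" "F \<subseteq> \<Delta>" "abstract_complex (\<Union>F) F"
    using F(1) by (auto simp: finite_subcomplex_def)
  let ?U = "U \<inter> {y \<in> topspace T. act h y \<in> W}"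
  have "finite (\<Union>F)"
    using F'(1,3) unfolding abstract_complex_def by (intro finite_Union) auto
  moreover have "\<Union>F \<subseteq> V"
    using F'(2) complex unfolding abstract_complex_def by auto
  moreover have "openin T ?U"
    using openin_continuous_map_preimage[OF cont[OF h] W(1)] U(1) by blast
  moreover have "act g y \<in> W" if "g \<in> agreeing_with G \<rho> h (\<Union>F)" "y \<in> ?U" for g y
    using act_eq_if_agree_on_support[OF that(1), of y] support_in_complex(3)[OF F'(3), of y] that(2) F(2)
    by auto
  ultimately show "\<exists>F U. finite F \<and> F \<subseteq> V \<and> openin T U \<and> x \<in> U \<and>
      (\<forall>g\<in>agreeing_with G \<rho> h F. \<forall>y\<in>U. act g y \<in> W)"
    using U(2) W(2) x T by (intro exI[of _ "\<Union>F"] exI[of _ ?U]) auto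
qed

text \<open>
  If \<open>g\<close> agrees with \<open>h\<close> on the support of \<open>x\<close>, then \<open>d (h x) (g y) = d (g x) (g y) = d x y\<close>.
  So the ball of radius \<open>r\<close> around \<open>x\<close> is carried into the ball of radius \<open>r\<close> around \<open>h x\<close>.
\<close>

theorem continuous_map_joint_evaluation_metric:
  assumes d: "Metric_space (realization \<Delta>) d"
    and iso: "\<And>g x y. g \<in> G \<Longrightarrow> x \<in> realization \<Delta> \<Longrightarrow> y \<in> realization \<Delta> \<Longrightarrow>
      d (act g x) (act g y) = d x y"
  shows "continuous_map (prod_topology vertex_topology (Metric_space.mtopology (realization \<Delta>) d))
    (Metric_space.mtopology (realization \<Delta>) d) (\<lambda>(g, x). act g x)"
proof -
  interpret Metric_space "realization \<Delta>" d by (rule d)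
  show ?thesis
  proof (rule continuous_map_joint_evaluationI)
    fix h x W assume h: "h \<in> G" and x: "x \<in> realization \<Delta>" and W: "openin mtopology W" "act h x \<in> W"
    then obtain r where r: "r > 0" "mball (act h x) r \<subseteq> W"
      unfolding openin_mtopology by blast
    note supp = support_in_complex[OF complex x]
    have "act g y \<in> W" if g: "g \<in> agreeing_with G \<rho> h {v. x v \<noteq> 0}" and y: "y \<in> mball x r" for g y
    proof -
      have gG: "g \<in> G" using g by (simp add: agreeing_with_def)
      have "d (act h x) (act g y) = d (act g x) (act g y)"
        using act_eq_if_agree_on_support[OF g] by simp
      also have "\<dots> < r" using iso[OF gG x] y by auto
      finally have "act g y \<in> mball (act h x) r"
        using act_closed h gG x y by auto
      then show ?thesis using r(2) by blast
    qed
    then show "\<exists>F U. finite F \<and> F \<subseteq> V \<and> openin mtopology U \<and> x \<in> U \<and>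
        (\<forall>g\<in>agreeing_with G \<rho> h F. \<forall>y\<in>U. act g y \<in> W)"
      using supp(2,3) r(1) x
      by (intro exI[of _ "{v. x v \<noteq> 0}"] exI[of _ "mball x r"]) auto
  qed simp
qed

end

section \<open>Automorphisms of a building and its residues\<close>

lemma building_Aut_carrierD:
  assumes "g \<in> carrier (building_Aut B)"
  shows "bij_betw g (chambers B) (chambers B)"
    and "a \<in> chambers B \<Longrightarrow> b \<in> chambers B \<Longrightarrow> adjacent B i (g a) (g b) \<longleftrightarrow> adjacent B i a b"
  using assms unfolding building_Aut_def Bij_def adjacent_def by auto

lemma gallery_map_iff:
  assumes "g \<in> carrier (building_Aut B)" "set cs \<subseteq> chambers B"
  shows "gallery B is (map g cs) \<longleftrightarrow> gallery B is cs"
proof -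
  have "set (map g cs) \<subseteq> chambers B"
    using building_Aut_carrierD(1)[OF assms(1)] assms(2) by (auto simp: bij_betw_def)
  moreover have "adjacent B i (map g cs ! s) (map g cs ! Suc s) \<longleftrightarrow> adjacent B i (cs ! s) (cs ! Suc s)"
    if "length cs = Suc (length is)" "s < length is" for i s
    using building_Aut_carrierD(2)[OF assms(1)] assms(2) that by (simp add: subset_iff)
  ultimately show ?thesis unfolding gallery_def using assms(2) by auto
qed

text \<open>
  Automorphisms carry galleries to galleries of the same type, and by surjectivity every gallery
  starting at \<open>g c\<close> is the image of one starting at \<open>c\<close>. Consequently the image of a residue is
  known once the image of one of its chambers is known.
\<close>

lemma automorphism_image_residue:
  assumes g: "g \<in> carrier (building_Aut B)" and c: "c \<in> chambers B"
  shows "g ` residue B J c = residue B J (g c)"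
proof (intro subset_antisym subsetI)
  have inj: "inj_on g (chambers B)" and im: "g ` chambers B = chambers B"
    using building_Aut_carrierD(1)[OF g] by (auto simp: bij_betw_def)
  show "e \<in> residue B J (g c)" if "e \<in> g ` residue B J c" for e
  proof -
    obtain js cs where *: "set js \<subseteq> J" "gallery B js cs" "hd cs = c" "e = g (last cs)"
      using \<open>e \<in> g ` residue B J c\<close> by (auto simp: residue_def)
    then have "cs \<noteq> []" "set cs \<subseteq> chambers B" by (auto simp: gallery_def)
    then show ?thesis
      using * gallery_map_iff[OF g] unfolding residue_def
      by (intro CollectI exI[of _ js] exI[of _ "map g cs"]) (auto simp: hd_map last_map)
  qed
  show "e \<in> g ` residue B J c" if "e \<in> residue B J (g c)" for e
  proof -
    obtain js ds where *: "set js \<subseteq> J" "gallery B js ds" "hd ds = g c" "e = last ds"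
      using \<open>e \<in> residue B J (g c)\<close> by (auto simp: residue_def)
    then have ds: "ds \<noteq> []" "ds \<in> lists (g ` chambers B)" by (auto simp: gallery_def im)
    then obtain cs where cs: "ds = map g cs" "set cs \<subseteq> chambers B"
      by (auto simp: lists_image)
    with ds have "cs \<noteq> []" by simp
    then have "hd cs = c" using *(3) cs c inj by (simp add: hd_map inj_on_eq_iff subset_iff)
    moreover have "gallery B js cs" using *(2) gallery_map_iff[OF g cs(2)] cs(1) by simp
    ultimately have "last cs \<in> residue B J c" using *(1) by (auto simp: residue_def)
    then show ?thesis using *(4) cs(1) \<open>cs \<noteq> []\<close> by (simp add: last_map)
  qed
qed

text \<open>
  Chambers are the residues of type \<open>{}\<close>, and these are spherical because the empty set
  generates the trivial group.
\<close>

lemma singleton_spherical_residue: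
  assumes "c \<in> chambers B"
  shows "{c} \<in> spherical_residues I m B"
proof -
  have "gallery B [] [c]" using assms by (simp add: gallery_def)
  then have "residue B {} c = {c}"
    by (auto simp: residue_def gallery_def length_Suc_conv intro!: exI[of _ "[c]"])
  moreover have "finite (parabolic I m {})"
    by (simp add: parabolic_def group.generate_empty[OF group_coxeter_group])
  ultimately show ?thesis using assms unfolding spherical_residues_def by blast
qed

text \<open>
  All residues of a simplex share a chamber \<open>c\<close>; applying \<open>g\<close> keeps their types and replaces
  \<open>c\<close> by \<open>g c\<close>.
\<close>

lemma simplicial_action_davis_complex:
  "simplicial_action (carrier (building_Aut B)) residue_action
    (spherical_residues I m B) (davis_complex I m B)"
proof
  show "abstract_complex (spherical_residues I m B) (davis_complex I m B)"
    by (rule abstract_complex_davis_complex)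
  fix g a assume g: "g \<in> carrier (building_Aut B)" and a: "a \<in> davis_complex I m B"
  show "residue_action g ` a \<in> davis_complex I m B"
  proof (cases "a = {}")
    case True then show ?thesis by (simp add: davis_complex_def)
  next
    case False
    with a obtain Js c where *: "a = (\<lambda>J. residue B J c) ` set Js" "c \<in> chambers B" "Js \<noteq> []"
      "set Js \<subseteq> Pow I" "sorted_wrt (\<subseteq>) Js" "finite (parabolic I m (last Js))"
      by (auto simp: davis_complex_def)
    have "residue_action g ` a = (\<lambda>J. residue B J (g c)) ` set Js"
      unfolding *(1) image_image residue_action_def automorphism_image_residue[OF g *(2)] ..
    moreover have "g c \<in> chambers B"
      using building_Aut_carrierD(1)[OF g] *(2) by (auto simp: bij_betw_def)
    ultimately show ?thesis using * unfolding davis_complex_def by blast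
  qed
qed

text \<open>
  Each evaluation in one topology is determined by a single evaluation in the other: \<open>g c\<close> by the
  image of the residue \<open>{c}\<close>, and the image of a residue containing \<open>c\<close>
  by \<open>g c\<close>.
\<close>

lemma pointwise_topology_residues_eq_chambers:
  "pointwise_topology (carrier (building_Aut B)) residue_action (discrete_topology (spherical_residues I m B))
    = pointwise_topology (carrier (building_Aut B)) (\<lambda>g. g) (discrete_topology (chambers B))"
    (is "?TV = ?TC")
proof (rule topology_eq_if_continuous_id)
  interpret simplicial_action "carrier (building_Aut B)" residue_action
    "spherical_residues I m B" "davis_complex I m B"
    by (rule simplicial_action_davis_complex)
  let ?G = "carrier (building_Aut B)"
  have closed: "(\<lambda>g. g) \<in> ?G \<rightarrow> chambers B \<rightarrow> chambers B"
    using building_Aut_carrierD(1) by (fastforce simp: bij_betw_def)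
  have top: "topspace ?TC = ?G"
    by (rule topspace_pointwise_topology) (use closed in simp)
  show "topspace ?TV = topspace ?TC"
    by (simp add: top topspace_vertex_topology)
  show "continuous_map ?TV ?TC (\<lambda>g. g)"
  proof (rule continuous_map_into_pointwise_topology)
    fix c assume "c \<in> topspace (discrete_topology (chambers B))"
    then have c: "c \<in> chambers B" by simp
    show "continuous_map ?TV (discrete_topology (chambers B)) (\<lambda>g. g c)"
    proof (rule continuous_map_if_finitely_determined[OF vertex_closed])
      show "{{c}} \<subseteq> spherical_residues I m B" using singleton_spherical_residue[OF c] by blast
      show "(\<lambda>g. g c) \<in> ?G \<rightarrow> topspace (discrete_topology (chambers B))" using closed c by auto
      show "g c = h c" if "\<And>R. R \<in> {{c}} \<Longrightarrow> residue_action g R = residue_action h R" for g h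
        using that[of "{c}"] by (simp add: residue_action_def)
    qed auto
  qed (simp add: topspace_vertex_topology)
  show "continuous_map ?TC ?TV (\<lambda>g. g)"
  proof (rule continuous_map_into_pointwise_topology)
    fix R assume "R \<in> topspace (discrete_topology (spherical_residues I m B))"
    then have RV: "R \<in> spherical_residues I m B" by simp
    then obtain J c where R: "R = residue B J c" and c: "c \<in> chambers B"
      by (auto simp: spherical_residues_def)
    show "continuous_map ?TC (discrete_topology (spherical_residues I m B)) (\<lambda>g. residue_action g R)"
    proof (rule continuous_map_if_finitely_determined[OF closed])
      show "{c} \<subseteq> chambers B" using c by simp
      show "(\<lambda>g. residue_action g R) \<in> ?G \<rightarrow> topspace (discrete_topology (spherical_residues I m B))"
        using vertex_closed RV by auto
      show "residue_action g R = residue_action h R"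
        if "g \<in> ?G" "h \<in> ?G" "\<And>x. x \<in> {c} \<Longrightarrow> g x = h x" for g h
        using that(3) automorphism_image_residue[OF that(1) c] automorphism_image_residue[OF that(2) c]
        by (simp add: residue_action_def R)
    qed auto
  qed (simp add: top)
qed

section \<open>The topologies on the automorphism group\<close>

theorem proposition5p10:
  fixes I :: "'i set" and m :: "'i \<Rightarrow> 'i \<Rightarrow> enat" and B :: "('c, 'i) building_data"
  assumes "building I m B"
  shows
    "let G = carrier (building_Aut B);
         C = chambers B;
         V = spherical_residues I m B;
         \<Delta> = davis_complex I m B;
         X = realization \<Delta>;
         VX = vertex_point ` V;
         \<T> = pointwise_topology G (\<lambda>g. g) (discrete_topology C)
     in
       pointwise_topology G residue_action (discrete_topology V) = \<T> \<and>
       (\<forall>T. topspace T = X \<and> Hausdorff_space T \<and> discrete_subset T VX \<longrightarrow>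
          pointwise_topology G davis_action T = \<T>) \<and>
       compact_open_topology G davis_action (weak_topology \<Delta>) = \<T> \<and>
       (\<forall>T. topspace T = X \<and> Hausdorff_space T \<and>
          ((\<forall>g\<in>G. homeomorphic_map T T (davis_action g)) \<and> locally_finite_topology \<Delta> T \<or>
           (\<exists>d. Metric_space X d \<and> T = Metric_space.mtopology X d \<and>
              (\<forall>g\<in>G. \<forall>x\<in>X. \<forall>y\<in>X. d (davis_action g x) (davis_action g y) = d x y) \<and>
              discrete_subset T VX)) \<longrightarrow>
          continuous_map (prod_topology \<T> T) T (\<lambda>(g, x). davis_action g x))"
proof -
  interpret simplicial_action "carrier (building_Aut B)" residue_action
    "spherical_residues I m B" "davis_complex I m B"
    by (rule simplicial_action_davis_complex)
  have act: "davis_action = (\<lambda>g. linear_extension (residue_action g))"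
    by (simp add: davis_action_def fun_eq_iff)
  show ?thesis
    unfolding Let_def act pointwise_topology_residues_eq_chambers[of B I m, symmetric]
  proof (intro conjI allI impI; (elim conjE)?)
    fix T
    assume T: "topspace T = realization (davis_complex I m B)"
    show "pointwise_topology (carrier (building_Aut B)) (\<lambda>g. linear_extension (residue_action g)) T
        = vertex_topology"
      if "discrete_subset T (vertex_point ` spherical_residues I m B)"
      using T that by (rule pointwise_topology_realization)
    assume "(\<forall>g\<in>carrier (building_Aut B). homeomorphic_map T T (linear_extension (residue_action g))) \<and>
        locally_finite_topology (davis_complex I m B) T \<or>
      (\<exists>d. Metric_space (realization (davis_complex I m B)) d \<and>
        T = Metric_space.mtopology (realization (davis_complex I m B)) d \<and>
        (\<forall>g\<in>carrier (building_Aut B). \<forall>x\<in>realization (davis_complex I m B).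
          \<forall>y\<in>realization (davis_complex I m B).
            d (linear_extension (residue_action g) x) (linear_extension (residue_action g) y) = d x y) \<and>
        discrete_subset T (vertex_point ` spherical_residues I m B))"
    then show "continuous_map (prod_topology vertex_topology T) T
        (\<lambda>(g, x). linear_extension (residue_action g) x)"
    proof (elim disjE exE conjE)
      assume "\<forall>g\<in>carrier (building_Aut B). homeomorphic_map T T (linear_extension (residue_action g))"
        and "locally_finite_topology (davis_complex I m B) T"
      then show ?thesis
        using T homeomorphic_imp_continuous_map
        by (intro continuous_map_joint_evaluation_locally_finite) blast+
    next
      fix d
      assume "Metric_space (realization (davis_complex I m B)) d"
        and mt: "T = Metric_space.mtopology (realization (davis_complex I m B)) d"
        and "\<forall>g\<in>carrier (building_Aut B). \<forall>x\<in>realization (davis_complex I m B).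
          \<forall>y\<in>realization (davis_complex I m B).
            d (linear_extension (residue_action g) x) (linear_extension (residue_action g) y) = d x y"
      then show ?thesis
        unfolding mt by (intro continuous_map_joint_evaluation_metric) blast+
    qed
  qed (simp_all add: compact_open_topology_realization)
qed

end
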